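(* For each integer $n\ge 2$ let $(x_k)_{k\ge 0}$ be the repeated averaging chain on $\mathbf{R}^n$ started from $x_0=(1,0,\ldots,0)$, and let $T(k)=\sum_{i=1}^n |x_{k,i}-\tfrac1n|$. Then, as $n\to\infty$, \[ T(\lfloor \theta n\log n\rfloor)\to 2 \text{ in probability for every } 0\le\theta<\frac{1}{2\log 2}, \] and \[ T(\lfloor \theta n\log n\rfloor)\to 0 \text{ in probability for every } \theta>\frac{1}{2\log 2}. \]
   Context: Repeated averaging chain on $\mathbf{R}^n$: given $x_k=(x_{k,1},\ldots,x_{k,n})$, pick a pair of distinct indices $I,J\in\{1,\ldots,n\}$ uniformly at random (independently of the past), replace both $x_{k,I}$ and $x_{k,J}$ by $(x_{k,I}+x_{k,J})/2$, and keep all other coordinates the same; the result is $x_{k+1}$. Here $\log$ is the natural logarithm. *)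

theory Defs
  imports "HOL-Probability.Probability"
begin

text \<open>Vectors of $\mathbf{R}^n$ are functions \<open>nat \<Rightarrow> real\<close> read at the indices
  \<open>1, \<dots>, n\<close>. Averaging steps at indices in that range leave all other values alone.\<close>

definition index_pairs :: "nat \<Rightarrow> (nat \<times> nat) set" where
  "index_pairs n = {(i, j). i \<in> {1..n} \<and> j \<in> {1..n} \<and> i \<noteq> j}"

definition average_pair :: "nat \<times> nat \<Rightarrow> (nat \<Rightarrow> real) \<Rightarrow> nat \<Rightarrow> real" where
  "average_pair = (\<lambda>(i, j) v. v(i := (v i + v j) / 2, j := (v i + v j) / 2))"

text \<open>The pairs are ordered, which does not matter as averaging is symmetric in \<open>i\<close> and \<open>j\<close>.
  The past of a step consists of the starting vector, which is deterministic, and the earlier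
  pairs, so independence of the past amounts to mutual independence of all pairs.\<close>

locale repeated_averaging_chain = prob_space M
  for M :: "'a measure" and n :: nat and v\<^sub>0 :: "nat \<Rightarrow> real"
    and IJ :: "nat \<Rightarrow> 'a \<Rightarrow> nat \<times> nat" and x :: "nat \<Rightarrow> 'a \<Rightarrow> nat \<Rightarrow> real" +
  assumes indep_pairs: "indep_vars (\<lambda>_. count_space (index_pairs n)) IJ UNIV"
    and uniform_pairs:
      "\<And>k. distr M (count_space (index_pairs n)) (IJ k) = uniform_count_measure (index_pairs n)"
    and start: "\<And>\<omega>. \<omega> \<in> space M \<Longrightarrow> x 0 \<omega> = v\<^sub>0"
    and step: "\<And>k \<omega>. \<omega> \<in> space M \<Longrightarrow> x (Suc k) \<omega> = average_pair (IJ k \<omega>) (x k \<omega>)"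

definition first_unit_vector :: "nat \<Rightarrow> real" where
  "first_unit_vector = (\<lambda>i. if i = 1 then 1 else 0)"

definition L1_dist_to_uniform :: "nat \<Rightarrow> (nat \<Rightarrow> real) \<Rightarrow> real" where
  "L1_dist_to_uniform n v = (\<Sum>i=1..n. \<bar>v i - 1 / real n\<bar>)"

text \<open>Convergence in probability to a constant, where each variable may live on its own
  probability space.\<close>

definition tendsto_in_probability ::
    "(nat \<Rightarrow> 'a measure) \<Rightarrow> (nat \<Rightarrow> 'a \<Rightarrow> real) \<Rightarrow> real \<Rightarrow> bool" where
  "tendsto_in_probability M X c \<longleftrightarrow>
     (\<forall>\<epsilon>>0. (\<lambda>n. measure (M n) {\<omega> \<in> space (M n). \<bar>X n \<omega> - c\<bar> > \<epsilon>}) \<longlonglongrightarrow> 0)"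

end

theory Submission
  imports Defs
begin

text \<open>Averaging \<open>a\<close> with a much smaller entry turns \<open>a\<^sup>p\<close> into about \<open>2 (a/2)\<^sup>p = 2\<^bsup>1-p\<^esup> a\<^sup>p\<close>, and each
  coordinate is selected with probability \<open>2/n\<close> per step. So the mean of \<open>\<Sum> x\<^sub>i\<^bsup>1-\<alpha>\<^esup>\<close> grows at most
  by the factor \<open>1 + 2 (2\<^sup>\<alpha> - 1) / n\<close>. As
  \<open>2 - T = 2 \<Sum> min x\<^sub>i (1/n) \<le> 2 n\<^bsup>-\<alpha>\<^esup> \<Sum> x\<^sub>i\<^bsup>1-\<alpha>\<^esup>\<close>, the mean of \<open>2 - T\<close> tends to 0 at times
  \<open>\<theta> n log n\<close> as soon as \<open>2 \<theta> (2\<^sup>\<alpha> - 1) < \<alpha>\<close>, and such an \<open>\<alpha>\<close> near 0 exists for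
  \<open>2 \<theta> log 2 < 1\<close>.

  Conversely, the mean of \<open>\<Sum> x\<^sub>i\<^bsup>1+\<alpha>\<^esup>\<close> contracts by \<open>1 - 2 (1 - 2\<^bsup>-\<alpha>\<^esup>) / n\<close> up to an additive error
  \<open>O(n\<^bsup>-1-\<alpha>\<^esup>)\<close> from the cross terms, so it drops to \<open>O(n\<^bsup>-\<alpha>\<^esup>)\<close> by a time \<open>\<theta>\<^sub>1 n log n\<close> with
  \<open>\<theta>\<^sub>1 < \<theta>\<close> if \<open>2 \<theta> log 2 > 1\<close>. Then all but a vanishing part of the mass lies below
  \<open>n\<^bsup>-1+\<epsilon>\<^esup>\<close>; the remaining \<open>2 \<epsilon> n log n\<close> steps flatten that part in mean square, while the rest
  stays negligible because the dynamics is linear.\<close>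

section \<open>The one-step averaging operator\<close>

text \<open>The expected value of \<open>F\<close> after one step from \<open>v\<close>. Estimates
  are made for iterates of this operator; probability spaces enter only when expectations are
  identified with these iterates and Markov's inequality is applied.\<close>

definition mean_step :: "nat \<Rightarrow> ((nat \<Rightarrow> real) \<Rightarrow> real) \<Rightarrow> (nat \<Rightarrow> real) \<Rightarrow> real" where
  "mean_step n F v = (\<Sum>p\<in>index_pairs n. F (average_pair p v)) / real (card (index_pairs n))"

lemma index_pairs_eq: "index_pairs n = {1..n} \<times> {1..n} - (\<lambda>i. (i, i)) ` {1..n}"
  by (auto simp: index_pairs_def)

lemma finite_index_pairs [simp]: "finite (index_pairs n)"
  by (simp add: index_pairs_eq)

lemma sum_index_pairs:
  fixes f :: "nat \<Rightarrow> nat \<Rightarrow> real"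
  shows "(\<Sum>(i, j)\<in>index_pairs n. f i j) = (\<Sum>i=1..n. \<Sum>j=1..n. f i j) - (\<Sum>i=1..n. f i i)"
proof -
  have "(\<Sum>(i, j)\<in>index_pairs n. f i j) =
      (\<Sum>(i, j)\<in>{1..n} \<times> {1..n}. f i j) - (\<Sum>(i, j)\<in>(\<lambda>i. (i, i)) ` {1..n}. f i j)"
    unfolding index_pairs_eq by (rule sum_diff) auto
  then show ?thesis
    by (simp add: sum.cartesian_product sum.reindex inj_on_def)
qed

lemma card_index_pairs: "real (card (index_pairs n)) = real n * (real n - 1)"
  using sum_index_pairs[of "\<lambda>_ _. 1" n] by (simp add: case_prod_unfold algebra_simps)

lemma card_index_pairs_pos: "n \<ge> 2 \<Longrightarrow> real (card (index_pairs n)) > 0"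
  by (simp add: card_index_pairs)

lemma mean_step_mono:
  assumes "\<And>p. p \<in> index_pairs n \<Longrightarrow> F (average_pair p v) \<le> G (average_pair p v)"
  shows "mean_step n F v \<le> mean_step n G v"
  unfolding mean_step_def by (intro divide_right_mono sum_mono assms) auto

lemma mean_step_add: "mean_step n (\<lambda>v. F v + G v) v = mean_step n F v + mean_step n G v"
  by (simp add: mean_step_def sum.distrib add_divide_distrib)

lemma mean_step_cmult: "mean_step n (\<lambda>v. c * F v) v = c * mean_step n F v"
  by (simp add: mean_step_def sum_distrib_left)

lemma mean_step_const: "n \<ge> 2 \<Longrightarrow> mean_step n (\<lambda>_. c) v = c"
  using card_index_pairs_pos[of n] by (auto simp: mean_step_def)

lemma funpow_mean_step_affine:
  assumes "n \<ge> 2"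
  shows "(mean_step n ^^ k) (\<lambda>v. a + b * F v) v = a + b * (mean_step n ^^ k) F v"
proof (induction k arbitrary: v)
  case (Suc k)
  then have "(mean_step n ^^ k) (\<lambda>v. a + b * F v) = (\<lambda>v. a + b * (mean_step n ^^ k) F v)"
    by blast
  then show ?case
    using assms by (simp add: mean_step_add mean_step_cmult mean_step_const)
qed simp

text \<open>Invariant sets of the chain: inequalities between functionals then have to hold on
  \<open>S\<close> only.\<close>

definition closed_under_averaging :: "nat \<Rightarrow> (nat \<Rightarrow> real) set \<Rightarrow> bool" where
  "closed_under_averaging n S \<longleftrightarrow> (\<forall>v\<in>S. \<forall>p\<in>index_pairs n. average_pair p v \<in> S)"

lemma funpow_mean_step_mono:
  assumes S: "closed_under_averaging n S" and le: "\<And>v. v \<in> S \<Longrightarrow> F v \<le> G v" and "v \<in> S"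
  shows "(mean_step n ^^ k) F v \<le> (mean_step n ^^ k) G v"
  using \<open>v \<in> S\<close>
proof (induction k arbitrary: v)
  case (Suc k)
  then show ?case
    using S by (auto intro!: mean_step_mono simp: closed_under_averaging_def)
qed (simp add: le)

text \<open>Iterates a one-step drift inequality; the additive errors pile up to a geometric
  sum.\<close>

lemma funpow_mean_step_le:
  assumes "n \<ge> 2" and S: "closed_under_averaging n S"
    and le: "\<And>v. v \<in> S \<Longrightarrow> mean_step n F v \<le> a * F v + b" and "0 \<le> a" and "v \<in> S"
  shows "(mean_step n ^^ k) F v \<le> a ^ k * F v + b * (\<Sum>j<k. a ^ j)"
  using \<open>v \<in> S\<close>
proof (induction k arbitrary: v)
  case (Suc k)
  \<comment> \<open>The outermost operator is the first step of the chain. The induction hypothesis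
    is therefore applied at \<open>average_pair p v\<close>, which stays in \<open>S\<close> by
    invariance.\<close>
  have "(mean_step n ^^ Suc k) F v \<le> mean_step n (\<lambda>v. b * (\<Sum>j<k. a ^ j) + a ^ k * F v) v"
    using S Suc.prems Suc.IH
    by (auto intro!: mean_step_mono simp: closed_under_averaging_def add.commute)
  also have "\<dots> = b * (\<Sum>j<k. a ^ j) + a ^ k * mean_step n F v"
    using \<open>n \<ge> 2\<close> by (simp add: mean_step_add mean_step_cmult mean_step_const)
  also have "\<dots> \<le> b * (\<Sum>j<k. a ^ j) + a ^ k * (a * F v + b)"
    using le[OF Suc.prems] \<open>0 \<le> a\<close> by (simp add: mult_left_mono)
  finally show ?case
    by (simp add: algebra_simps)
qed simp

text \<open>Unrolls the iterate into a uniform average over all sequences of \<open>k\<close> pairs,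
  the form in which it can be compared with the law of the random pairs.\<close>

lemma funpow_mean_step_eq_sum_lists:
  assumes "n \<ge> 2"
  shows "(mean_step n ^^ k) F v =
    (\<Sum>ps | set ps \<subseteq> index_pairs n \<and> length ps = k. F (fold average_pair ps v))
      / real (card (index_pairs n)) ^ k"
proof (induction k arbitrary: v)
  case (Suc k)
  let ?L = "\<lambda>k. {ps. set ps \<subseteq> index_pairs n \<and> length ps = k}"
  let ?N = "real (card (index_pairs n))"
  have "(\<Sum>ps\<in>?L (Suc k). F (fold average_pair ps v)) =
      (\<Sum>(ps, p)\<in>?L k \<times> index_pairs n. F (fold average_pair ps (average_pair p v)))"
    unfolding lists_length_Suc_eq
    by (subst sum.reindex) (auto simp: inj_on_def case_prod_unfold)
  also have "\<dots> = (\<Sum>p\<in>index_pairs n. \<Sum>ps\<in>?L k. F (fold average_pair ps (average_pair p v)))"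
    by (subst sum.swap) (simp add: sum.cartesian_product)
  also have "\<dots> = (\<Sum>p\<in>index_pairs n. ?N ^ k * (mean_step n ^^ k) F (average_pair p v))"
    using card_index_pairs_pos[OF assms] by (intro sum.cong) (auto simp: Suc.IH)
  also have "\<dots> = ?N ^ Suc k * (mean_step n ^^ Suc k) F v"
    using card_index_pairs_pos[OF assms]
    by (simp add: mean_step_def flip: sum_distrib_left)
  finally show ?case
    using card_index_pairs_pos[OF assms] by auto
qed (simp add: Collect_conv_if)

section \<open>Expectations along the random chain\<close>

context repeated_averaging_chain
begin

lemma measurable_pair: "IJ k \<in> measurable M (count_space (index_pairs n))"
  using indep_pairs by (simp add: indep_vars_def)

lemma chain_eq_fold:
  "\<omega> \<in> space M \<Longrightarrow> x k \<omega> = fold average_pair (map (\<lambda>i. IJ i \<omega>) [0..<k]) v\<^sub>0"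
  by (induction k) (simp_all add: start step)

lemma prob_pair:
  assumes "p \<in> index_pairs n"
  shows "prob (IJ k -` {p} \<inter> space M) = 1 / real (card (index_pairs n))"
proof -
  have "prob (IJ k -` {p} \<inter> space M) =
      measure (distr M (count_space (index_pairs n)) (IJ k)) {p}"
    using assms by (intro measure_distr[symmetric] measurable_pair) auto
  then show ?thesis
    using assms by (simp add: uniform_pairs measure_uniform_count_measure)
qed

text \<open>Independence and uniformity make all sequences of pairs of a given length equally
  likely.\<close>

lemma prob_pairs_eq_list:
  assumes "set ps \<subseteq> index_pairs n"
  shows "{\<omega> \<in> space M. map (\<lambda>i. IJ i \<omega>) [0..<length ps] = ps} \<in> events" (is "?E \<in> _")
    and "prob {\<omega> \<in> space M. map (\<lambda>i. IJ i \<omega>) [0..<length ps] = ps} =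
      1 / real (card (index_pairs n)) ^ length ps"
proof -
  let ?A = "\<lambda>i. IJ i -` {ps ! i} \<inter> space M"
  have nth: "ps ! i \<in> index_pairs n" if "i < length ps" for i
    using assms that by auto
  have "?E \<in> events \<and> prob ?E = 1 / real (card (index_pairs n)) ^ length ps"
  \<comment> \<open>The product rule for independent variables asks for a nonempty index set, so the
    empty sequence is treated separately.\<close>
  proof (cases "ps = []")
    case True
    then show ?thesis
      by (simp add: prob_space)
  next
    case False
    have "map (\<lambda>i. IJ i \<omega>) [0..<length ps] = ps \<longleftrightarrow> (\<forall>i<length ps. IJ i \<omega> = ps ! i)" for \<omega>
      unfolding list_eq_iff_nth_eq[of _ ps] by simp
    then have E: "?E = (\<Inter>i\<in>{..<length ps}. ?A i)"
      using False by auto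
    have "?A i \<in> events" if "i < length ps" for i
      using nth[OF that] by (intro measurable_sets[OF measurable_pair]) auto
    then have "?E \<in> events"
      unfolding E using False by (intro sets.finite_INT) auto
    moreover have "prob ?E = (\<Prod>i\<in>{..<length ps}. prob (?A i))"
      unfolding E using False nth by (intro indep_varsD[OF indep_pairs]) auto
    moreover have "\<dots> = (\<Prod>i\<in>{..<length ps}. 1 / real (card (index_pairs n)))"
      by (intro prod.cong) (auto simp: prob_pair[OF nth])
    ultimately show ?thesis
      by (simp add: power_one_over)
  qed
  then show "?E \<in> events" "prob ?E = 1 / real (card (index_pairs n)) ^ length ps"
    by auto
qed

text \<open>The state after \<open>k\<close> steps depends only on the first \<open>k\<close> pairs,
  which take finitely many values. Hence \<open>F (x k \<omega>)\<close> is a finite combination of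
  indicators of path events, and \<open>F\<close> may be arbitrary.\<close>

lemma has_bochner_integral_chain:
  assumes "n \<ge> 2"
  shows "has_bochner_integral M (\<lambda>\<omega>. F (x k \<omega>)) ((mean_step n ^^ k) F v\<^sub>0)"
proof -
  let ?L = "{ps. set ps \<subseteq> index_pairs n \<and> length ps = k}"
  let ?path = "\<lambda>\<omega>. map (\<lambda>i. IJ i \<omega>) [0..<k]"
  let ?E = "\<lambda>ps. {\<omega> \<in> space M. ?path \<omega> = ps}"
  have "has_bochner_integral M
      (\<lambda>\<omega>. \<Sum>ps\<in>?L. indicator (?E ps) \<omega> * F (fold average_pair ps v\<^sub>0))
      (\<Sum>ps\<in>?L. 1 / real (card (index_pairs n)) ^ k * F (fold average_pair ps v\<^sub>0))"
  proof (intro has_bochner_integral_sum has_bochner_integral_mult_left)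
    fix ps assume "ps \<in> ?L"
    then have "?E ps \<in> events" "prob (?E ps) = 1 / real (card (index_pairs n)) ^ k"
      using prob_pairs_eq_list[of ps] by auto
    then show "has_bochner_integral M (indicator (?E ps)) (1 / real (card (index_pairs n)) ^ k)"
      using has_bochner_integral_real_indicator[of "?E ps" M] by (simp add: emeasure_eq_measure)
  qed
  moreover have eq: "(\<Sum>ps\<in>?L. indicator (?E ps) \<omega> * F (fold average_pair ps v\<^sub>0)) = F (x k \<omega>)"
    if \<omega>: "\<omega> \<in> space M" for \<omega>
  proof -
    have "?path \<omega> \<in> ?L"
      using measurable_space[OF measurable_pair \<omega>] by auto
    moreover have "finite ?L"
      by (simp add: finite_lists_length_eq)
    moreover have "(\<Sum>ps\<in>?L. indicator (?E ps) \<omega> * F (fold average_pair ps v\<^sub>0)) =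
        (\<Sum>ps\<in>?L. if ?path \<omega> = ps then F (fold average_pair ps v\<^sub>0) else 0)"
      using \<omega> by (intro sum.cong) auto
    ultimately show ?thesis
      using \<omega> by (simp add: chain_eq_fold)
  qed
  ultimately have "has_bochner_integral M (\<lambda>\<omega>. F (x k \<omega>))
      (\<Sum>ps\<in>?L. 1 / real (card (index_pairs n)) ^ k * F (fold average_pair ps v\<^sub>0))"
    by (subst has_bochner_integral_cong[OF refl eq[symmetric] refl])
  then show ?thesis
    unfolding funpow_mean_step_eq_sum_lists[OF assms] by (simp add: sum_divide_distrib)
qed

lemma chain_Markov_inequality:
  assumes "n \<ge> 2" and "\<And>v. 0 \<le> F v" and "0 < \<epsilon>"
  shows "prob {\<omega> \<in> space M. F (x k \<omega>) > \<epsilon>} \<le> (mean_step n ^^ k) F v\<^sub>0 / \<epsilon>"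
proof -
  note int = has_bochner_integral_chain[OF \<open>n \<ge> 2\<close>, of F k]
  have F: "integrable M (\<lambda>\<omega>. F (x k \<omega>))"
    using int by (rule integrable.intros)
  have [measurable]: "(\<lambda>\<omega>. F (x k \<omega>)) \<in> borel_measurable M"
    using F by auto
  have "prob {\<omega> \<in> space M. F (x k \<omega>) > \<epsilon>} \<le> prob {\<omega> \<in> space M. F (x k \<omega>) \<ge> \<epsilon>}"
    by (intro finite_measure_mono) auto
  also have "\<dots> \<le> (\<integral>\<omega>. F (x k \<omega>) \<partial>M) / \<epsilon>"
    using F assms by (intro integral_Markov_inequality_measure[where A = "space M"]) auto
  finally show ?thesis
    using int by (simp add: has_bochner_integral_iff)
qed

end

section \<open>Power sums along the chain\<close>

text \<open>Only the two selected entries change, and both become the same average.\<close>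

lemma sum_average_pair:
  fixes \<phi> :: "real \<Rightarrow> real"
  assumes "(i, j) \<in> index_pairs n"
  shows "(\<Sum>l=1..n. \<phi> (average_pair (i, j) v l)) =
    (\<Sum>l=1..n. \<phi> (v l)) + (2 * \<phi> ((v i + v j) / 2) - \<phi> (v i) - \<phi> (v j))"
proof -
  have ij: "i \<in> {1..n}" "j \<in> {1..n} - {i}"
    using assms by (auto simp: index_pairs_def)
  have split: "(\<Sum>l=1..n. f l) = f i + (f j + (\<Sum>l\<in>{1..n} - {i} - {j}. f l))" for f :: "nat \<Rightarrow> real"
    using sum.remove[of "{1..n}" i f] sum.remove[of "{1..n} - {i}" j f] ij by simp
  have "(\<Sum>l\<in>{1..n} - {i} - {j}. \<phi> (average_pair (i, j) v l)) = (\<Sum>l\<in>{1..n} - {i} - {j}. \<phi> (v l))"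
    by (intro sum.cong) (auto simp: average_pair_def)
  then show ?thesis
    unfolding split using ij by (simp add: average_pair_def)
qed

lemma sum_average_pair_id:
  "p \<in> index_pairs n \<Longrightarrow> (\<Sum>l=1..n. average_pair p v l) = (\<Sum>l=1..n. v l)"
  for v :: "nat \<Rightarrow> real"
  using sum_average_pair[of "fst p" "snd p" n "\<lambda>t. t" v] by (simp add: field_simps)

lemma average_pair_nonneg: "(\<And>l. 0 \<le> v l) \<Longrightarrow> 0 \<le> average_pair p v l"
  by (simp add: average_pair_def case_prod_unfold)

lemma mean_step_sum:
  assumes "n \<ge> 2"
  shows "mean_step n (\<lambda>v. \<Sum>l=1..n. \<phi> (v l)) v = (\<Sum>l=1..n. \<phi> (v l)) +
    (\<Sum>(i, j)\<in>index_pairs n. 2 * \<phi> ((v i + v j) / 2) - \<phi> (v i) - \<phi> (v j)) / (real n * (real n - 1))"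
proof -
  let ?D = "\<lambda>(i, j). 2 * \<phi> ((v i + v j) / 2) - \<phi> (v i) - \<phi> (v j)"
  have "(\<Sum>p\<in>index_pairs n. \<Sum>l=1..n. \<phi> (average_pair p v l)) =
      (\<Sum>p\<in>index_pairs n. (\<Sum>l=1..n. \<phi> (v l)) + ?D p)"
    using sum_average_pair by (intro sum.cong) (auto simp: case_prod_unfold)
  also have "\<dots> = real (card (index_pairs n)) * (\<Sum>l=1..n. \<phi> (v l)) + (\<Sum>p\<in>index_pairs n. ?D p)"
    by (simp add: sum.distrib)
  finally show ?thesis
    using card_index_pairs_pos[OF assms]
    by (simp add: mean_step_def add_divide_distrib flip: card_index_pairs) auto
qed

lemma sum_index_pairs_add:
  fixes f :: "nat \<Rightarrow> real"
  shows "(\<Sum>(i, j)\<in>index_pairs n. f i + f j) = 2 * (real n - 1) * (\<Sum>i=1..n. f i)"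
  by (simp add: sum_index_pairs sum.distrib sum_distrib_left algebra_simps)

text \<open>Each index lies in \<open>2 * (n - 1)\<close> of the \<open>n * (n - 1)\<close> ordered
  pairs, so a relative change \<open>c\<close> on the selected pair becomes \<open>2 * c / n\<close>
  for the whole sum; the error \<open>r\<close> is averaged over the pairs.\<close>

lemma mean_step_sum_le:
  assumes "n \<ge> 2"
    and le: "\<And>i j. (i, j) \<in> index_pairs n \<Longrightarrow>
      2 * \<phi> ((v i + v j) / 2) \<le> (1 + c) * (\<phi> (v i) + \<phi> (v j)) + r i j"
  shows "mean_step n (\<lambda>v. \<Sum>l=1..n. \<phi> (v l)) v \<le>
    (1 + 2 * c / real n) * (\<Sum>l=1..n. \<phi> (v l)) +
    (\<Sum>(i, j)\<in>index_pairs n. r i j) / (real n * (real n - 1))"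
proof -
  have "(\<Sum>(i, j)\<in>index_pairs n. 2 * \<phi> ((v i + v j) / 2) - \<phi> (v i) - \<phi> (v j)) \<le>
      (\<Sum>(i, j)\<in>index_pairs n. c * (\<phi> (v i) + \<phi> (v j)) + r i j)"
    using le by (intro sum_mono) (fastforce simp: algebra_simps)
  also have "\<dots> = c * (\<Sum>(i, j)\<in>index_pairs n. \<phi> (v i) + \<phi> (v j)) + (\<Sum>(i, j)\<in>index_pairs n. r i j)"
    by (simp add: case_prod_unfold sum.distrib flip: sum_distrib_left)
  finally have "(\<Sum>(i, j)\<in>index_pairs n. 2 * \<phi> ((v i + v j) / 2) - \<phi> (v i) - \<phi> (v j))
        / (real n * (real n - 1))
      \<le> (c * (2 * (real n - 1) * (\<Sum>l=1..n. \<phi> (v l))) + (\<Sum>(i, j)\<in>index_pairs n. r i j))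
        / (real n * (real n - 1))"
    using \<open>n \<ge> 2\<close> unfolding sum_index_pairs_add by (intro divide_right_mono) auto
  also have "\<dots> = 2 * c / real n * (\<Sum>l=1..n. \<phi> (v l)) +
      (\<Sum>(i, j)\<in>index_pairs n. r i j) / (real n * (real n - 1))"
    using \<open>n \<ge> 2\<close> by (simp add: field_simps)
  finally show ?thesis
    unfolding mean_step_sum[OF \<open>n \<ge> 2\<close>] by (simp add: algebra_simps)
qed

text \<open>The mass \<open>s\<close> is a parameter because the upper bound also runs the chain
  from the excess of a probability vector over a level, whose mass need not be 1.\<close>

definition nonneg_vectors :: "nat \<Rightarrow> real \<Rightarrow> (nat \<Rightarrow> real) set" where
  "nonneg_vectors n s = {v. (\<forall>i. 0 \<le> v i) \<and> (\<Sum>i=1..n. v i) = s}"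

abbreviation prob_vectors :: "nat \<Rightarrow> (nat \<Rightarrow> real) set" where
  "prob_vectors n \<equiv> nonneg_vectors n 1"

lemma closed_under_averaging_nonneg_vectors: "closed_under_averaging n (nonneg_vectors n s)"
  by (auto simp: closed_under_averaging_def nonneg_vectors_def sum_average_pair_id
      simp del: One_nat_def intro!: average_pair_nonneg)

lemma first_unit_vector_prob_vector: "n \<ge> 1 \<Longrightarrow> first_unit_vector \<in> prob_vectors n"
  by (auto simp: nonneg_vectors_def first_unit_vector_def)

section \<open>The lower bound\<close>

text \<open>As \<open>p - 1\<close> is at most 0, each of \<open>a\<close> and \<open>b\<close>
  satisfies \<open>t * (a + b) powr (p - 1) \<le> t powr p\<close>; adding the two gives
  subadditivity.\<close>

lemma powr_add_le:
  fixes a b p :: real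
  assumes "0 \<le> a" "0 \<le> b" "0 < p" "p \<le> 1"
  shows "(a + b) powr p \<le> a powr p + b powr p"
proof (cases "a + b = 0")
  case False
  then have "0 < a + b"
    using assms by linarith
  have le: "t * (a + b) powr (p - 1) \<le> t powr p" if "0 \<le> t" "t \<le> a + b" for t
  proof (cases "t = 0")
    case False
    then have "t * (a + b) powr (p - 1) \<le> t * t powr (p - 1)"
      using that assms by (intro mult_left_mono powr_mono2') auto
    then show ?thesis
      using that False by (simp add: powr_mult_base)
  qed simp
  have "(a + b) powr p = (a + b) * (a + b) powr (p - 1)"
    using \<open>0 < a + b\<close> by (simp add: powr_mult_base)
  also have "\<dots> \<le> a powr p + b powr p"
    using le[of a] le[of b] assms by (simp add: distrib_right)
  finally show ?thesis .
qed (use assms in auto)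

lemma min_le_powr_mult_powr:
  fixes s t \<alpha> :: real
  assumes "0 \<le> s" "0 < t" "0 < \<alpha>" "\<alpha> < 1"
  shows "min s t \<le> s powr (1 - \<alpha>) * t powr \<alpha>"
proof -
  have "min s t = min s t powr (1 - \<alpha>) * min s t powr \<alpha>"
    using assms by (simp flip: powr_add)
  also have "\<dots> \<le> s powr (1 - \<alpha>) * t powr \<alpha>"
    using assms by (intro mult_mono powr_mono2) auto
  finally show ?thesis .
qed

text \<open>Sum \<open>\<bar>a - b\<bar> = a + b - 2 * min a b\<close> over the entries of two
  vectors of mass 1.\<close>

lemma L1_dist_to_uniform_eq_min:
  assumes "n \<ge> 1" "v \<in> prob_vectors n"
  shows "L1_dist_to_uniform n v = 2 - 2 * (\<Sum>i=1..n. min (v i) (1 / real n))"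
proof -
  have "L1_dist_to_uniform n v = (\<Sum>i=1..n. v i + 1 / real n - 2 * min (v i) (1 / real n))"
    unfolding L1_dist_to_uniform_def by (intro sum.cong) (auto simp: min_def)
  then show ?thesis
    using assms by (simp add: sum.distrib sum_subtractf sum_distrib_left nonneg_vectors_def)
qed

lemma abs_L1_dist_to_uniform_minus_2_le:
  assumes "n \<ge> 1" "v \<in> prob_vectors n" "0 < \<alpha>" "\<alpha> < 1"
  shows "\<bar>L1_dist_to_uniform n v - 2\<bar> \<le> 2 * real n powr - \<alpha> * (\<Sum>i=1..n. v i powr (1 - \<alpha>))"
proof -
  have v: "0 \<le> v i" for i
    using assms by (auto simp: nonneg_vectors_def)
  have "0 \<le> (\<Sum>i=1..n. min (v i) (1 / real n))"
    using v by (intro sum_nonneg) auto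
  then have "\<bar>L1_dist_to_uniform n v - 2\<bar> = 2 * (\<Sum>i=1..n. min (v i) (1 / real n))"
    using L1_dist_to_uniform_eq_min[OF assms(1,2)] by simp
  also have "\<dots> \<le> 2 * (\<Sum>i=1..n. v i powr (1 - \<alpha>) * (1 / real n) powr \<alpha>)"
    using assms v by (intro mult_left_mono sum_mono min_le_powr_mult_powr) auto
  also have "\<dots> = 2 * real n powr - \<alpha> * (\<Sum>i=1..n. v i powr (1 - \<alpha>))"
    using assms by (simp add: powr_divide powr_minus_divide flip: sum_divide_distrib)
  finally show ?thesis .
qed

text \<open>By subadditivity of the power, averaging multiplies the contribution of the selected
  pair by at most \<open>2 powr \<alpha>\<close>. This drift is iterated and compounded through
  \<open>1 + t \<le> exp t\<close>.\<close>

lemma funpow_mean_step_sum_powr_lower: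
  assumes "n \<ge> 2" "v \<in> prob_vectors n" "0 < \<alpha>" "\<alpha> < 1"
  shows "(mean_step n ^^ k) (\<lambda>v. \<Sum>i=1..n. v i powr (1 - \<alpha>)) v
    \<le> exp (2 * (2 powr \<alpha> - 1) * real k / real n) * (\<Sum>i=1..n. v i powr (1 - \<alpha>))"
proof -
  let ?c = "2 powr \<alpha> - 1"
  have c: "0 \<le> ?c"
    using assms by (simp add: ge_one_powr_ge_zero)
  have "mean_step n (\<lambda>v. \<Sum>i=1..n. v i powr (1 - \<alpha>)) v \<le>
      (1 + 2 * ?c / real n) * (\<Sum>i=1..n. v i powr (1 - \<alpha>)) + 0" if "v \<in> prob_vectors n" for v
  proof -
    have v: "0 \<le> v i" for i
      using that by (auto simp: nonneg_vectors_def)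
    have "2 * ((v i + v j) / 2) powr (1 - \<alpha>) \<le>
        (1 + ?c) * (v i powr (1 - \<alpha>) + v j powr (1 - \<alpha>)) + 0" for i j
    proof -
      have "2 * ((v i + v j) / 2) powr (1 - \<alpha>) = 2 powr \<alpha> * (v i + v j) powr (1 - \<alpha>)"
        using v by (simp add: powr_divide powr_diff)
      then show ?thesis
        using powr_add_le[of "v i" "v j" "1 - \<alpha>"] assms v by simp
    qed
    then show ?thesis
      using mean_step_sum_le[OF \<open>n \<ge> 2\<close>, where r = "\<lambda>_ _. 0"] by fastforce
  qed
  then have "(mean_step n ^^ k) (\<lambda>v. \<Sum>i=1..n. v i powr (1 - \<alpha>)) v \<le>
      (1 + 2 * ?c / real n) ^ k * (\<Sum>i=1..n. v i powr (1 - \<alpha>))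
        + 0 * (\<Sum>j<k. (1 + 2 * ?c / real n) ^ j)"
    by (intro funpow_mean_step_le[OF \<open>n \<ge> 2\<close> closed_under_averaging_nonneg_vectors])
      (use c assms in auto)
  also have "\<dots> \<le> exp (2 * ?c / real n) ^ k * (\<Sum>i=1..n. v i powr (1 - \<alpha>))"
    using c by (auto intro!: mult_right_mono power_mono exp_ge_add_one_self sum_nonneg)
  also have "exp (2 * ?c / real n) ^ k = exp (2 * ?c * real k / real n)"
    by (simp add: mult_ac flip: exp_of_nat_mult)
  finally show ?thesis .
qed

lemma funpow_mean_step_L1_dist_minus_2_le:
  assumes "n \<ge> 2" "0 < \<alpha>" "\<alpha> < 1"
  shows "(mean_step n ^^ k) (\<lambda>v. \<bar>L1_dist_to_uniform n v - 2\<bar>) first_unit_vector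
    \<le> 2 * real n powr - \<alpha> * exp (2 * (2 powr \<alpha> - 1) * real k / real n)"
proof -
  have e: "first_unit_vector \<in> prob_vectors n"
    using assms by (simp add: first_unit_vector_prob_vector)
  have "(\<Sum>i=1..n. first_unit_vector i powr (1 - \<alpha>)) = (\<Sum>i=1..n. if i = 1 then 1 else 0)"
    by (intro sum.cong) (auto simp: first_unit_vector_def)
  then have one: "(\<Sum>i=1..n. first_unit_vector i powr (1 - \<alpha>)) = 1"
    using assms by simp
  have "(mean_step n ^^ k) (\<lambda>v. \<bar>L1_dist_to_uniform n v - 2\<bar>) first_unit_vector \<le>
      (mean_step n ^^ k) (\<lambda>v. 0 + 2 * real n powr - \<alpha> * (\<Sum>i=1..n. v i powr (1 - \<alpha>))) first_unit_vector"
    using assms e abs_L1_dist_to_uniform_minus_2_le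
    by (intro funpow_mean_step_mono[OF closed_under_averaging_nonneg_vectors]) auto
  also have "\<dots> = 2 * real n powr - \<alpha> * (mean_step n ^^ k) (\<lambda>v. \<Sum>i=1..n. v i powr (1 - \<alpha>)) first_unit_vector"
    by (subst funpow_mean_step_affine[OF assms(1)]) simp
  also have "\<dots> \<le> 2 * real n powr - \<alpha> * exp (2 * (2 powr \<alpha> - 1) * real k / real n)"
    using funpow_mean_step_sum_powr_lower[OF assms(1) e assms(2,3), of k] unfolding one
    by (intro mult_left_mono) auto
  finally show ?thesis .
qed

section \<open>The upper bound\<close>

text \<open>Split off one factor \<open>a + b\<close> and use subadditivity for the remaining power
  \<open>\<alpha>\<close>; the last bracket collects the cross terms.\<close>

lemma powr_one_plus_add_le:
  fixes a b \<alpha> :: real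
  assumes "0 \<le> a" "0 \<le> b" "0 < \<alpha>" "\<alpha> \<le> 1"
  shows "(a + b) powr (1 + \<alpha>) \<le> a powr (1 + \<alpha>) + b powr (1 + \<alpha>) + (a powr \<alpha> * b + a * b powr \<alpha>)"
proof -
  have "(a + b) powr (1 + \<alpha>) = (a + b) * (a + b) powr \<alpha>"
    using assms by (simp add: powr_mult_base)
  also have "\<dots> \<le> (a + b) * (a powr \<alpha> + b powr \<alpha>)"
    using assms by (intro mult_left_mono powr_add_le) auto
  also have "\<dots> = a powr (1 + \<alpha>) + b powr (1 + \<alpha>) + (a powr \<alpha> * b + a * b powr \<alpha>)"
    using assms by (simp add: algebra_simps powr_mult_base)
  finally show ?thesis .
qed

text \<open>Up to the factor 2, the uniform vector is extremal. The bound follows entrywise from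
  \<open>t powr \<alpha> \<le> 1 + t\<close> at \<open>t = n * v i\<close>, which is linear in
  \<open>v i\<close>.\<close>

lemma sum_powr_le:
  assumes "n \<ge> 1" "v \<in> prob_vectors n" "0 < \<alpha>" "\<alpha> < 1"
  shows "(\<Sum>i=1..n. v i powr \<alpha>) \<le> 2 * real n powr (1 - \<alpha>)"
proof -
  have v: "0 \<le> v i" for i
    using assms by (auto simp: nonneg_vectors_def)
  have "v i powr \<alpha> \<le> real n powr - \<alpha> * (1 + real n * v i)" for i
  proof -
    have "(real n * v i) powr \<alpha> \<le> (1 + real n * v i) powr \<alpha>"
      using assms v by (intro powr_mono2) auto
    also have "\<dots> \<le> (1 + real n * v i) powr 1"
      using assms v by (intro powr_mono) auto
    finally have "real n powr \<alpha> * v i powr \<alpha> \<le> 1 + real n * v i"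
      using v by (simp add: powr_mult)
    then show ?thesis
      using assms by (simp add: powr_minus field_simps)
  qed
  then have "(\<Sum>i=1..n. v i powr \<alpha>) \<le> (\<Sum>i=1..n. real n powr - \<alpha> * (1 + real n * v i))"
    by (rule sum_mono)
  also have "\<dots> = real n powr - \<alpha> * (real n + real n * (\<Sum>i=1..n. v i))"
    by (simp add: sum.distrib flip: sum_distrib_left)
  also have "\<dots> = 2 * (real n * real n powr - \<alpha>)"
    using assms by (simp add: nonneg_vectors_def)
  also have "real n * real n powr - \<alpha> = real n powr (1 - \<alpha>)"
    by (simp add: powr_mult_base)
  finally show ?thesis .
qed

text \<open>The drift inequality has factor \<open>a < 1\<close> and error \<open>b\<close>. The
  first term is the decay of the initial value 1, the second is the fixed point
  \<open>b / (1 - a)\<close> of the affine recursion.\<close>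

lemma funpow_mean_step_sum_powr_upper:
  assumes "n \<ge> 2" "0 < \<alpha>" "\<alpha> < 1"
  defines "c \<equiv> 1 - 2 powr - \<alpha>"
  shows "(mean_step n ^^ k) (\<lambda>v. \<Sum>i=1..n. v i powr (1 + \<alpha>)) first_unit_vector
    \<le> exp (- (2 * c * real k / real n)) + 4 / c * real n powr - \<alpha>"
proof -
  let ?F = "\<lambda>v. \<Sum>i=1..n. v i powr (1 + \<alpha>)"
  define a where "a = 1 + 2 * (- c) / real n"
  \<comment> \<open>The cross terms sum to at most \<open>4 * n powr (1 - \<alpha>)\<close>, and
    dividing by \<open>n * (n - 1)\<close>, which is at least half of the square of
    \<open>n\<close>, gives the constant 8.\<close>
  define b where "b = 8 * real n powr - \<alpha> / real n"
  have "2 powr - \<alpha> < (2::real) powr 0"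
    using assms by (intro powr_less_mono) auto
  then have c: "0 < c" "c < 1"
    by (auto simp: c_def)
  have a: "0 \<le> a" "a < 1" "a \<le> exp (- (2 * c / real n))"
    using c \<open>n \<ge> 2\<close> exp_ge_add_one_self[of "- (2 * c / real n)"] by (auto simp: a_def field_simps)
  have e: "first_unit_vector \<in> prob_vectors n"
    using assms by (simp add: first_unit_vector_prob_vector)
  have "?F first_unit_vector = (\<Sum>i=1..n. if i = 1 then 1 else 0)"
    by (intro sum.cong) (auto simp: first_unit_vector_def)
  then have one: "?F first_unit_vector = 1"
    using assms by simp
  have "mean_step n ?F v \<le> a * ?F v + b" if "v \<in> prob_vectors n" for v
  proof -
    have v: "0 \<le> v i" "(\<Sum>i=1..n. v i) = 1" for i
      using that by (auto simp: nonneg_vectors_def)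
    let ?r = "\<lambda>i j. v i powr \<alpha> * v j + v i * v j powr \<alpha>"
    have "2 * ((v i + v j) / 2) powr (1 + \<alpha>) \<le>
        (1 + - c) * (v i powr (1 + \<alpha>) + v j powr (1 + \<alpha>)) + ?r i j" for i j
    proof -
      have "2 * ((v i + v j) / 2) powr (1 + \<alpha>) = 2 powr - \<alpha> * (v i + v j) powr (1 + \<alpha>)"
        using v by (simp add: powr_divide powr_add powr_minus field_simps)
      also have "\<dots> \<le> 2 powr - \<alpha> * (v i powr (1 + \<alpha>) + v j powr (1 + \<alpha>) + ?r i j)"
        using v assms by (intro mult_left_mono powr_one_plus_add_le) auto
      also have "\<dots> = 2 powr - \<alpha> * (v i powr (1 + \<alpha>) + v j powr (1 + \<alpha>)) + 2 powr - \<alpha> * ?r i j"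
        by (simp add: distrib_left)
      also have "2 powr - \<alpha> * ?r i j \<le> 1 * ?r i j"
        using v c by (intro mult_right_mono) (auto simp: c_def)
      finally show ?thesis
        by (simp add: c_def)
    qed
    then have "mean_step n ?F v \<le> a * ?F v + (\<Sum>(i, j)\<in>index_pairs n. ?r i j) / (real n * (real n - 1))"
      unfolding a_def by (intro mean_step_sum_le \<open>n \<ge> 2\<close>) auto
    \<comment> \<open>Putting the nonnegative diagonal terms back makes the double sum factor, with
      one factor equal to the total mass 1.\<close>
    also have "(\<Sum>(i, j)\<in>index_pairs n. ?r i j) \<le> (\<Sum>i=1..n. \<Sum>j=1..n. ?r i j)"
      using v by (auto simp: sum_index_pairs intro!: sum_nonneg)
    also have "\<dots> = 2 * (\<Sum>i=1..n. v i powr \<alpha>)"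
      by (simp add: sum.distrib v flip: sum_distrib_left sum_distrib_right del: One_nat_def)
    also have "\<dots> \<le> 2 * (2 * real n powr (1 - \<alpha>))"
      using assms that by (intro mult_left_mono sum_powr_le) auto
    also have "\<dots> = 4 * real n powr - \<alpha> * real n"
      by (simp add: powr_mult_base mult.commute)
    also have "4 * real n powr - \<alpha> * real n / (real n * (real n - 1)) = 4 * real n powr - \<alpha> / (real n - 1)"
      using \<open>n \<ge> 2\<close> by simp
    also have "\<dots> \<le> 4 * real n powr - \<alpha> / (real n / 2)"
      using \<open>n \<ge> 2\<close> by (intro divide_left_mono) auto
    also have "\<dots> = b"
      by (simp add: b_def)
    finally show ?thesis
      using \<open>n \<ge> 2\<close> by (simp add: divide_right_mono)
  qed
  then have "(mean_step n ^^ k) ?F first_unit_vector \<le> a ^ k * 1 + b * (\<Sum>j<k. a ^ j)"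
    using funpow_mean_step_le[OF \<open>n \<ge> 2\<close> closed_under_averaging_nonneg_vectors _ \<open>0 \<le> a\<close> e] one
    by fastforce
  also have "a ^ k \<le> exp (- (2 * c / real n)) ^ k"
    using a by (intro power_mono) auto
  also have "\<dots> = exp (- (2 * c * real k / real n))"
    by (simp add: mult_ac flip: exp_of_nat_mult)
  also have "b * (\<Sum>j<k. a ^ j) = b * ((1 - a ^ k) / (1 - a))"
    using a by (simp add: sum_gp_strict)
  also have "\<dots> \<le> b * (1 / (1 - a))"
    using a by (intro mult_left_mono divide_right_mono) (auto simp: b_def)
  also have "\<dots> = 4 / c * real n powr - \<alpha>"
    using c \<open>n \<ge> 2\<close> by (simp add: a_def b_def)
  finally show ?thesis
    by simp
qed

section \<open>Mean-square contraction and truncation\<close>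

definition sq_dist_to_mean :: "nat \<Rightarrow> (nat \<Rightarrow> real) \<Rightarrow> real" where
  "sq_dist_to_mean n v = (\<Sum>i=1..n. (v i - (\<Sum>i=1..n. v i) / real n)\<^sup>2)"

text \<open>Agrees with \<open>L1_dist_to_uniform\<close> on probability vectors. Centring at the
  vector's own mean makes the distance subadditive and suited to pieces of any mass.\<close>

definition L1_dist_to_mean :: "nat \<Rightarrow> (nat \<Rightarrow> real) \<Rightarrow> real" where
  "L1_dist_to_mean n v = (\<Sum>i=1..n. \<bar>v i - (\<Sum>i=1..n. v i) / real n\<bar>)"

lemma sq_dist_to_mean_eq:
  assumes "n \<ge> 1"
  shows "sq_dist_to_mean n v = (\<Sum>i=1..n. (v i)\<^sup>2) - (\<Sum>i=1..n. v i)\<^sup>2 / real n"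
proof -
  define s where "s = (\<Sum>i=1..n. v i)"
  have "sq_dist_to_mean n v = (\<Sum>i=1..n. (v i)\<^sup>2 - 2 * s / real n * v i + (s / real n)\<^sup>2)"
    unfolding sq_dist_to_mean_def s_def[symmetric]
    by (intro sum.cong) (auto simp: power2_diff algebra_simps)
  also have "\<dots> = (\<Sum>i=1..n. (v i)\<^sup>2) - 2 * s / real n * s + real n * (s / real n)\<^sup>2"
    unfolding sum.distrib sum_subtractf sum_distrib_left[symmetric] by (simp add: s_def)
  also have "\<dots> = (\<Sum>i=1..n. (v i)\<^sup>2) - s\<^sup>2 / real n"
    using assms by (simp add: power2_eq_square)
  finally show ?thesis
    by (simp add: s_def)
qed

text \<open>The mean is preserved, so only the sum of squares moves. Averaging a pair lowers it by
  half the squared difference of the two entries, whose mean over all pairs is the squared distance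
  divided by \<open>n - 1\<close>.\<close>

lemma mean_step_sq_dist_to_mean:
  assumes "n \<ge> 2"
  shows "mean_step n (sq_dist_to_mean n) v = (1 - 1 / (real n - 1)) * sq_dist_to_mean n v"
proof -
  let ?s = "\<Sum>i=1..n. v i" and ?q = "\<Sum>i=1..n. (v i)\<^sup>2"
  have "(\<Sum>p\<in>index_pairs n. sq_dist_to_mean n (average_pair p v)) =
      (\<Sum>p\<in>index_pairs n. (\<Sum>i=1..n. (average_pair p v i)\<^sup>2) + - (?s\<^sup>2 / real n))"
    using assms by (intro sum.cong) (simp_all add: sq_dist_to_mean_eq sum_average_pair_id del: One_nat_def)
  then have "mean_step n (sq_dist_to_mean n) v =
      mean_step n (\<lambda>v. (\<Sum>i=1..n. (v i)\<^sup>2) + - (?s\<^sup>2 / real n)) v"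
    by (simp add: mean_step_def)
  also have "\<dots> = mean_step n (\<lambda>v. \<Sum>i=1..n. (v i)\<^sup>2) v - ?s\<^sup>2 / real n"
    unfolding mean_step_add by (simp add: mean_step_const[OF assms])
  finally have U: "mean_step n (sq_dist_to_mean n) v = mean_step n (\<lambda>v. \<Sum>i=1..n. (v i)\<^sup>2) v - ?s\<^sup>2 / real n" .
  have "(\<Sum>(i, j)\<in>index_pairs n. 2 * ((v i + v j) / 2)\<^sup>2 - (v i)\<^sup>2 - (v j)\<^sup>2) =
      (\<Sum>(i, j)\<in>index_pairs n. v i * v j - ((v i)\<^sup>2 + (v j)\<^sup>2) / 2)"
    by (intro sum.cong) (auto simp: power2_eq_square field_simps)
  also have "\<dots> = (\<Sum>(i, j)\<in>index_pairs n. v i * v j) - (\<Sum>(i, j)\<in>index_pairs n. (v i)\<^sup>2 + (v j)\<^sup>2) / 2"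
    by (simp add: case_prod_unfold sum_subtractf sum_divide_distrib)
  also have "\<dots> = ?s\<^sup>2 - ?q - (real n - 1) * ?q"
    unfolding sum_index_pairs_add
    by (simp add: sum_index_pairs power2_eq_square sum_product)
  finally have "mean_step n (sq_dist_to_mean n) v =
      ?q + (?s\<^sup>2 - ?q - (real n - 1) * ?q) / (real n * (real n - 1)) - ?s\<^sup>2 / real n"
    unfolding U mean_step_sum[OF assms, of "\<lambda>t. t\<^sup>2"] by (simp only:)
  also have "\<dots> = (1 - 1 / (real n - 1)) * (?q - ?s\<^sup>2 / real n)"
    using assms by (simp add: divide_simps) (simp add: algebra_simps)
  finally show ?thesis
    using assms by (simp add: sq_dist_to_mean_eq)
qed

text \<open>Entrywise, either \<open>\<bar>t\<bar> \<le> \<delta> / n\<close> or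
  \<open>\<bar>t\<bar>\<close> is at most its square times \<open>n / \<delta>\<close>. A bound
  affine in the squared distance passes through expectations directly, unlike one with a square
  root.\<close>

lemma L1_dist_to_mean_le_sq_dist:
  assumes "n \<ge> 1" "0 < \<delta>"
  shows "L1_dist_to_mean n v \<le> \<delta> + real n / \<delta> * sq_dist_to_mean n v"
proof -
  have le: "\<bar>t\<bar> \<le> \<delta> / real n + real n / \<delta> * t\<^sup>2" for t
  proof (cases "\<bar>t\<bar> \<le> \<delta> / real n")
    case True
    then show ?thesis
      using assms by (simp add: add_increasing2)
  next
    case False
    then have "1 \<le> real n / \<delta> * \<bar>t\<bar>"
      using assms by (simp add: field_simps)
    then have "\<bar>t\<bar> * 1 \<le> \<bar>t\<bar> * (real n / \<delta> * \<bar>t\<bar>)"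
      by (rule mult_left_mono) simp
    also have "\<dots> = real n / \<delta> * \<bar>t\<bar>\<^sup>2"
      by (simp add: power2_eq_square)
    finally show ?thesis
      using assms by (simp add: add_increasing)
  qed
  have "L1_dist_to_mean n v \<le>
      (\<Sum>i=1..n. \<delta> / real n + real n / \<delta> * (v i - (\<Sum>i=1..n. v i) / real n)\<^sup>2)"
    unfolding L1_dist_to_mean_def by (intro sum_mono le)
  then show ?thesis
    using assms by (simp add: sum.distrib sq_dist_to_mean_def sum_distrib_left sum_divide_distrib)
qed

lemma L1_dist_to_mean_le_twice_sum:
  assumes "n \<ge> 1" "v \<in> nonneg_vectors n s"
  shows "L1_dist_to_mean n v \<le> 2 * s"
proof -
  have v: "0 \<le> v i" "(\<Sum>i=1..n. v i) = s" for i
    using assms by (auto simp: nonneg_vectors_def)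
  have "0 \<le> s"
    unfolding v(2)[symmetric] by (intro sum_nonneg v)
  then have "\<bar>v i - s / real n\<bar> \<le> v i + s / real n" for i
    using v(1)[of i] by (simp add: abs_le_iff)
  then have "L1_dist_to_mean n v \<le> (\<Sum>i=1..n. v i + s / real n)"
    unfolding L1_dist_to_mean_def v by (intro sum_mono)
  then show ?thesis
    using assms v by (simp add: sum.distrib del: One_nat_def)
qed

lemma L1_dist_to_mean_add_le:
  "L1_dist_to_mean n (\<lambda>i. y i + z i) \<le> L1_dist_to_mean n y + L1_dist_to_mean n z"
  unfolding L1_dist_to_mean_def sum.distrib[symmetric] by (intro sum_mono) (simp add: add_divide_distrib sum.distrib)

text \<open>For fixed pairs averaging is linear in the vector, so the two summands can be run with
  the same pairs.\<close>

lemma funpow_mean_step_L1_dist_add_le: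
  "(mean_step n ^^ k) (L1_dist_to_mean n) (\<lambda>i. y i + z i) \<le>
    (mean_step n ^^ k) (L1_dist_to_mean n) y + (mean_step n ^^ k) (L1_dist_to_mean n) z"
proof (induction k arbitrary: y z)
  case (Suc k)
  have "average_pair p (\<lambda>i. y i + z i) = (\<lambda>i. average_pair p y i + average_pair p z i)" for p
    by (auto simp: average_pair_def case_prod_unfold add_divide_distrib fun_eq_iff)
  then show ?case
    using Suc.IH by (simp add: mean_step_def sum_mono divide_right_mono flip: add_divide_distrib sum.distrib)
qed (simp add: L1_dist_to_mean_add_le)

text \<open>Entries below \<open>L\<close> contract in mean square; by linearity the excess over \<open>L\<close> keeps contributing
  at most twice its mass.\<close>

lemma funpow_mean_step_L1_dist_le:
  assumes "n \<ge> 2" "v \<in> prob_vectors n" "0 < \<delta>" "0 < L" "0 < \<alpha>"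
  shows "(mean_step n ^^ m) (L1_dist_to_uniform n) v \<le>
    \<delta> + real n / \<delta> * exp (- real m / real n) * L + 2 * L powr - \<alpha> * (\<Sum>i=1..n. v i powr (1 + \<alpha>))"
proof -
  have v: "0 \<le> v i" "(\<Sum>i=1..n. v i) = 1" for i
    using assms by (auto simp: nonneg_vectors_def)
  define y where "y i = min (v i) L" for i
  define z where "z i = v i - y i" for i
  let ?U = "mean_step n ^^ m" and ?a = "1 - 1 / (real n - 1)" and ?s = "\<Sum>i=1..n. z i"
  have "?U (L1_dist_to_uniform n) v \<le> ?U (L1_dist_to_mean n) v"
    using assms by (intro funpow_mean_step_mono[OF closed_under_averaging_nonneg_vectors])
      (auto simp: nonneg_vectors_def L1_dist_to_uniform_def L1_dist_to_mean_def simp del: One_nat_def)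
  also have "v = (\<lambda>i. y i + z i)"
    by (simp add: z_def)
  also have "?U (L1_dist_to_mean n) \<dots> \<le> ?U (L1_dist_to_mean n) y + ?U (L1_dist_to_mean n) z"
    by (rule funpow_mean_step_L1_dist_add_le)
  also have "?U (L1_dist_to_mean n) y \<le> \<delta> + real n / \<delta> * exp (- real m / real n) * L"
  proof -
    have "?U (L1_dist_to_mean n) y \<le> ?U (\<lambda>v. \<delta> + real n / \<delta> * sq_dist_to_mean n v) y"
      using assms by (intro funpow_mean_step_mono[where S = UNIV] L1_dist_to_mean_le_sq_dist)
        (auto simp: closed_under_averaging_def)
    also have "\<dots> = \<delta> + real n / \<delta> * ?U (sq_dist_to_mean n) y"
      by (rule funpow_mean_step_affine[OF \<open>n \<ge> 2\<close>])
    finally have U: "?U (L1_dist_to_mean n) y \<le> \<delta> + real n / \<delta> * ?U (sq_dist_to_mean n) y" .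
    have "?U (sq_dist_to_mean n) y \<le> ?a ^ m * sq_dist_to_mean n y + 0 * (\<Sum>j<m. ?a ^ j)"
      using \<open>n \<ge> 2\<close> by (intro funpow_mean_step_le[where S = UNIV])
        (auto simp: closed_under_averaging_def mean_step_sq_dist_to_mean)
    also have "\<dots> \<le> exp (- real m / real n) * L"
    proof -
      have "?a \<le> exp (- (1 / (real n - 1)))"
        using exp_ge_add_one_self[of "- (1 / (real n - 1))"] by simp
      also have "\<dots> \<le> exp (- (1 / real n))"
        using \<open>n \<ge> 2\<close> by (simp add: frac_le)
      finally have "?a ^ m \<le> exp (- (1 / real n)) ^ m"
        using \<open>n \<ge> 2\<close> by (intro power_mono) auto
      then have 1: "?a ^ m \<le> exp (- real m / real n)"
        by (simp flip: exp_of_nat_mult)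
      have "sq_dist_to_mean n y \<le> (\<Sum>i=1..n. (y i)\<^sup>2)"
        using assms by (simp add: sq_dist_to_mean_eq)
      \<comment> \<open>One factor \<open>y i\<close> is bounded by the level \<open>L\<close>, the
        other by \<open>v i\<close>, which has mass 1.\<close>
      also have "\<dots> \<le> (\<Sum>i=1..n. L * v i)"
        unfolding power2_eq_square using v \<open>0 < L\<close> by (intro sum_mono mult_mono) (auto simp: y_def)
      also have "\<dots> = L"
        using v by (simp flip: sum_distrib_left)
      finally have 2: "sq_dist_to_mean n y \<le> L" .
      have "0 \<le> sq_dist_to_mean n y"
        by (simp add: sq_dist_to_mean_def sum_nonneg)
      then show ?thesis
        using mult_mono[OF 1 2] by simp
    qed
    finally have "real n / \<delta> * ?U (sq_dist_to_mean n) y \<le> real n / \<delta> * (exp (- real m / real n) * L)"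
      using \<open>0 < \<delta>\<close> by (intro mult_left_mono) auto
    then show ?thesis
      using U by (simp add: mult.assoc)
  qed
  also have "?U (L1_dist_to_mean n) z \<le> 2 * L powr - \<alpha> * (\<Sum>i=1..n. v i powr (1 + \<alpha>))"
  proof -
    \<comment> \<open>The zero coefficient writes the constant \<open>2 * ?s\<close> as an affine
      functional, so that its iterate can be evaluated.\<close>
    have "?U (L1_dist_to_mean n) z \<le> ?U (\<lambda>v. 2 * ?s + 0 * L1_dist_to_mean n v) z"
      using assms L1_dist_to_mean_le_twice_sum[of n _ ?s]
      by (intro funpow_mean_step_mono[OF closed_under_averaging_nonneg_vectors[of n ?s]])
        (auto simp: nonneg_vectors_def z_def y_def)
    also have "\<dots> = 2 * ?s"
      by (subst funpow_mean_step_affine[OF \<open>n \<ge> 2\<close>]) simp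
    \<comment> \<open>A Markov-type bound: the excess vanishes unless \<open>v i > L\<close>, and
      then \<open>v i powr \<alpha>\<close> is at least \<open>L powr \<alpha>\<close>.\<close>
    also have "?s \<le> (\<Sum>i=1..n. L powr - \<alpha> * v i powr (1 + \<alpha>))"
    proof (rule sum_mono)
      fix i
      show "z i \<le> L powr - \<alpha> * v i powr (1 + \<alpha>)"
      proof (cases "v i \<le> L")
        case False
        then have "L powr \<alpha> \<le> v i powr \<alpha>"
          using assms by (intro powr_mono2) auto
        then have "1 \<le> L powr - \<alpha> * v i powr \<alpha>"
          using \<open>0 < L\<close> by (simp add: powr_minus field_simps)
        then have "v i * 1 \<le> v i * (L powr - \<alpha> * v i powr \<alpha>)"
          using v by (intro mult_left_mono)
        also have "\<dots> = L powr - \<alpha> * v i powr (1 + \<alpha>)"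
          using v by (simp add: powr_mult_base mult.left_commute)
        finally show ?thesis
          using False \<open>0 < L\<close> by (simp add: z_def y_def)
      qed (simp add: z_def y_def)
    qed
    finally show ?thesis
      by (simp add: mult_left_mono mult.assoc flip: sum_distrib_left)
  qed
  finally show ?thesis
    by (simp add: z_def)
qed

section \<open>The phase transition\<close>

text \<open>The difference of the two sides vanishes at 0 with derivative
  \<open>2 * \<theta> * ln 2 - 1\<close>, which is negative below the threshold; hence it is
  negative just to the right of 0.\<close>

lemma ex_exponent_lower:
  fixes \<theta> :: real
  assumes "0 \<le> \<theta>" "\<theta> < 1 / (2 * ln 2)"
  obtains \<alpha> where "0 < \<alpha>" "\<alpha> < 1" "2 * \<theta> * (2 powr \<alpha> - 1) < \<alpha>"
proof -
  let ?f = "\<lambda>\<alpha>. 2 * \<theta> * (2 powr \<alpha> - 1) - \<alpha>"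
  have "(?f has_real_derivative 2 * \<theta> * ln 2 - 1) (at 0)"
    by (auto intro!: derivative_eq_intros)
  moreover have "2 * \<theta> * ln 2 - 1 < 0"
    using assms by (simp add: field_simps)
  ultimately obtain d where "0 < d" and d: "\<And>h. 0 < h \<Longrightarrow> h < d \<Longrightarrow> ?f (0 + h) < ?f 0"
    using DERIV_neg_dec_right by blast
  show thesis
  proof (rule that)
    \<comment> \<open>The minimum with 1/2 keeps the exponent both inside the interval of length
      \<open>d\<close> and below 1.\<close>
    show "2 * \<theta> * (2 powr min (d / 2) (1 / 2) - 1) < min (d / 2) (1 / 2)"
      using d[of "min (d / 2) (1 / 2)"] \<open>0 < d\<close> by (simp add: min_def split: if_splits)
  qed (use \<open>0 < d\<close> in auto)
qed

text \<open>Here the derivative at 0 is again \<open>2 * \<theta> * ln 2 - 1\<close>, now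
  positive.\<close>

lemma ex_exponent_upper:
  fixes \<theta> :: real
  assumes "\<theta> > 1 / (2 * ln 2)"
  obtains \<alpha> where "0 < \<alpha>" "\<alpha> < 1" "\<alpha> < 2 * \<theta> * (1 - 2 powr - \<alpha>)"
proof -
  let ?f = "\<lambda>\<alpha>. 2 * \<theta> * (1 - 2 powr - \<alpha>) - \<alpha>"
  have "(?f has_real_derivative 2 * \<theta> * ln 2 - 1) (at 0)"
    by (auto intro!: derivative_eq_intros)
  moreover have "0 < 2 * \<theta> * ln 2 - 1"
    using assms by (simp add: field_simps)
  ultimately obtain d where "0 < d" and d: "\<And>h. 0 < h \<Longrightarrow> h < d \<Longrightarrow> ?f 0 < ?f (0 + h)"
    using DERIV_pos_inc_right by blast
  show thesis
  proof (rule that)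
    show "min (d / 2) (1 / 2) < 2 * \<theta> * (1 - 2 powr - min (d / 2) (1 / 2))"
      using d[of "min (d / 2) (1 / 2)"] \<open>0 < d\<close> by (simp add: min_def split: if_splits)
  qed (use \<open>0 < d\<close> in auto)
qed

text \<open>Convergence in mean implies convergence in probability, by Markov's inequality on each
  space separately.\<close>

lemma tendsto_in_probability_chainI:
  assumes chain: "\<And>n. n \<ge> 2 \<Longrightarrow> repeated_averaging_chain (M n) n v\<^sub>0 (IJ n) (x n)"
    and bound: "\<And>n. n \<ge> 2 \<Longrightarrow> (mean_step n ^^ K n) (\<lambda>v. \<bar>G n v - c\<bar>) v\<^sub>0 \<le> B n"
    and "B \<longlonglongrightarrow> 0"
  shows "tendsto_in_probability M (\<lambda>n \<omega>. G n (x n (K n) \<omega>)) c"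
  unfolding tendsto_in_probability_def
proof (intro allI impI)
  fix \<epsilon> :: real
  assume "\<epsilon> > 0"
  have "measure (M n) {\<omega> \<in> space (M n). \<bar>G n (x n (K n) \<omega>) - c\<bar> > \<epsilon>} \<le> B n / \<epsilon>" if "n \<ge> 2" for n
  proof -
    interpret repeated_averaging_chain "M n" n v\<^sub>0 "IJ n" "x n"
      by (rule chain[OF that])
    have "prob {\<omega> \<in> space (M n). \<bar>G n (x n (K n) \<omega>) - c\<bar> > \<epsilon>} \<le>
        (mean_step n ^^ K n) (\<lambda>v. \<bar>G n v - c\<bar>) v\<^sub>0 / \<epsilon>"
      using that \<open>\<epsilon> > 0\<close> by (intro chain_Markov_inequality) auto
    also have "\<dots> \<le> B n / \<epsilon>"
      using bound[OF that] \<open>\<epsilon> > 0\<close> by (intro divide_right_mono) auto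
    finally show ?thesis .
  qed
  then have "\<forall>\<^sub>F n in sequentially.
      norm (measure (M n) {\<omega> \<in> space (M n). \<bar>G n (x n (K n) \<omega>) - c\<bar> > \<epsilon>}) \<le> B n / \<epsilon>"
    by (intro eventually_sequentiallyI[of 2]) simp
  moreover have "(\<lambda>n. B n / \<epsilon>) \<longlonglongrightarrow> 0"
    using \<open>B \<longlonglongrightarrow> 0\<close> by (rule tendsto_divide_zero)
  ultimately show "(\<lambda>n. measure (M n) {\<omega> \<in> space (M n). \<bar>G n (x n (K n) \<omega>) - c\<bar> > \<epsilon>}) \<longlonglongrightarrow> 0"
    by (rule Lim_null_comparison)
qed

lemma tendsto_real_powr_neg: "p < 0 \<Longrightarrow> (\<lambda>n. real n powr p) \<longlonglongrightarrow> 0"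
  by (intro tendsto_neg_powr filterlim_real_sequentially)

text \<open>Rounding the time down only helps, since the growth bound increases with time. At the
  unrounded time the exponential is a power of \<open>n\<close>.\<close>

lemma mean_L1_dist_minus_2_le:
  fixes \<theta> \<alpha> :: real
  assumes "n \<ge> 2" "0 \<le> \<theta>" "0 < \<alpha>" "\<alpha> < 1"
  shows "(mean_step n ^^ nat \<lfloor>\<theta> * real n * ln (real n)\<rfloor>)
      (\<lambda>v. \<bar>L1_dist_to_uniform n v - 2\<bar>) first_unit_vector
    \<le> 2 * real n powr (2 * \<theta> * (2 powr \<alpha> - 1) - \<alpha>)"
proof -
  let ?k = "nat \<lfloor>\<theta> * real n * ln (real n)\<rfloor>" and ?c = "2 powr \<alpha> - 1"
  have c: "0 \<le> ?c"
    using assms by (simp add: ge_one_powr_ge_zero)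
  have "real ?k \<le> \<theta> * real n * ln (real n)"
    using assms by (intro of_nat_floor) auto
  then have "2 * ?c * real ?k / real n \<le> 2 * ?c * (\<theta> * real n * ln (real n)) / real n"
    using c by (intro divide_right_mono mult_left_mono) auto
  also have "\<dots> = 2 * \<theta> * ?c * ln (real n)"
    using assms by simp
  finally have "exp (2 * ?c * real ?k / real n) \<le> real n powr (2 * \<theta> * ?c)"
    using assms by (simp add: powr_def)
  then have "2 * real n powr - \<alpha> * exp (2 * ?c * real ?k / real n)
      \<le> 2 * real n powr - \<alpha> * real n powr (2 * \<theta> * ?c)"
    by (intro mult_left_mono) auto
  also have "\<dots> = 2 * real n powr (2 * \<theta> * ?c - \<alpha>)"
    by (simp flip: powr_add)
  finally show ?thesis
    using funpow_mean_step_L1_dist_minus_2_le[OF assms(1,3,4), of ?k] by simp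
qed

text \<open>Two phases: up to time about \<open>\<theta>\<^sub>1 * n * ln n\<close> the power sum
  drops to order \<open>n powr - \<alpha>\<close>; the other
  \<open>2 * \<epsilon> * n * ln n\<close> or so steps flatten what lies below a level
  \<open>L\<close>.\<close>

lemma mean_L1_dist_le:
  fixes \<theta> \<theta>\<^sub>1 \<alpha> :: real
  assumes "n \<ge> 2" "0 \<le> \<theta>\<^sub>1" "\<theta>\<^sub>1 < \<theta>" "0 < \<alpha>" "\<alpha> < 1" and exponent: "\<alpha> < 2 * \<theta>\<^sub>1 * (1 - 2 powr - \<alpha>)"
  defines "\<epsilon> \<equiv> (\<theta> - \<theta>\<^sub>1) / 2"
  shows "(mean_step n ^^ nat \<lfloor>\<theta> * real n * ln (real n)\<rfloor>) (L1_dist_to_uniform n) first_unit_vector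
    \<le> (1 + exp 1) * real n powr (- \<epsilon> / 2)
      + 2 * (exp 1 + 4 / (1 - 2 powr - \<alpha>)) * real n powr (- \<alpha> * \<epsilon>)"
proof -
  let ?\<Psi> = "\<lambda>v. \<Sum>i=1..n. v i powr (1 + \<alpha>)"
  define c where "c = 1 - 2 powr - \<alpha>"
  define l where "l = ln (real n)"
  define k\<^sub>1 where "k\<^sub>1 = nat \<lfloor>\<theta>\<^sub>1 * real n * l\<rfloor>"
  define k where "k = nat \<lfloor>\<theta> * real n * l\<rfloor>"
  define m where "m = k - k\<^sub>1"
  \<comment> \<open>With these choices the flattening term has exponent \<open>1 + \<epsilon> / 2 -
    2 * \<epsilon> + (\<epsilon> - 1) = - \<epsilon> / 2\<close>, matching \<open>\<delta>\<close>,
    and the mass above \<open>L\<close> contributes exponent \<open>(1 - \<epsilon>) * \<alpha> -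
    \<alpha> = - \<alpha> * \<epsilon>\<close>.\<close>
  define L where "L = real n powr (\<epsilon> - 1)"
  define \<delta> where "\<delta> = real n powr (- \<epsilon> / 2)"
  have n: "real n \<ge> 2" "0 < l" and L: "0 < L" and \<delta>: "0 < \<delta>"
    using assms by (auto simp: l_def L_def \<delta>_def)
  have "2 powr - \<alpha> < (2::real) powr 0"
    using assms by (intro powr_less_mono) auto
  then have c: "0 < c" "c < 1"
    by (auto simp: c_def)
  have "\<theta>\<^sub>1 * real n * l \<le> \<theta> * real n * l"
    using assms n by (intro mult_right_mono) auto
  then have "k\<^sub>1 \<le> k"
    unfolding k_def k\<^sub>1_def by (intro nat_mono floor_mono)
  then have "k = k\<^sub>1 + m"
    by (simp add: m_def)
  have "0 \<le> \<theta>\<^sub>1 * real n * l" "0 \<le> \<theta> * real n * l"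
    using assms n by auto
  then have k: "real k\<^sub>1 \<le> \<theta>\<^sub>1 * real n * l" "\<theta>\<^sub>1 * real n * l - 1 \<le> real k\<^sub>1" "\<theta> * real n * l - 1 \<le> real k"
    unfolding k_def k\<^sub>1_def by linarith+
  \<comment> \<open>Rounding costs at most one step, which the factor \<open>exp 1\<close> absorbs
    below.\<close>
  have "2 * \<epsilon> * l * real n - 1 \<le> real m"
    using k \<open>k = k\<^sub>1 + m\<close> by (simp add: \<epsilon>_def algebra_simps)
  then have "- real m / real n \<le> 1 / real n - 2 * \<epsilon> * l"
    using n by (simp add: field_simps)
  also have "\<dots> \<le> 1 - 2 * \<epsilon> * l"
    using n by simp
  finally have "exp (- real m / real n) \<le> exp 1 * real n powr (- 2 * \<epsilon>)"
    using n by (simp add: powr_def l_def exp_diff exp_minus field_simps flip: exp_add)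
  then have "real n / \<delta> * exp (- real m / real n) * L \<le> real n / \<delta> * (exp 1 * real n powr (- 2 * \<epsilon>)) * L"
    using L \<delta> by (intro mult_right_mono mult_left_mono) auto
  also have "\<dots> = exp 1 * (real n powr 1 * real n powr (\<epsilon> / 2) * real n powr (- 2 * \<epsilon>) * real n powr (\<epsilon> - 1))"
    using n by (simp add: L_def \<delta>_def powr_minus_divide)
  also have "\<dots> = exp 1 * real n powr (- \<epsilon> / 2)"
    unfolding powr_add[symmetric] by simp
  finally have mid: "real n / \<delta> * exp (- real m / real n) * L \<le> exp 1 * real n powr (- \<epsilon> / 2)" .
  have "- (2 * c * real k\<^sub>1 / real n) \<le> - (2 * c * (\<theta>\<^sub>1 * real n * l - 1) / real n)"
    using k c n by (simp add: divide_right_mono mult_left_mono)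
  also have "\<dots> = 2 * c / real n - 2 * \<theta>\<^sub>1 * c * l"
    using n by (simp add: field_simps)
  also have "\<dots> \<le> 1 - \<alpha> * l"
  proof -
    have "2 * c / real n \<le> 1"
      using c n by simp
    moreover have "\<alpha> * l \<le> 2 * \<theta>\<^sub>1 * c * l"
      using exponent n by (intro mult_right_mono) (auto simp: c_def)
    ultimately show ?thesis
      by simp
  qed
  finally have "exp (- (2 * c * real k\<^sub>1 / real n)) \<le> exp 1 * real n powr - \<alpha>"
    using n by (simp add: powr_def l_def exp_diff exp_minus field_simps flip: exp_add)
  then have \<Psi>: "(mean_step n ^^ k\<^sub>1) ?\<Psi> first_unit_vector \<le> (exp 1 + 4 / c) * real n powr - \<alpha>"
    using funpow_mean_step_sum_powr_upper[OF assms(1,4,5), of k\<^sub>1] by (simp add: c_def distrib_right)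
  \<comment> \<open>The Markov property in operator form: the inner iterate is the second phase, run
    from the state reached after \<open>k\<^sub>1\<close> steps.\<close>
  have "(mean_step n ^^ k) (L1_dist_to_uniform n) first_unit_vector =
      (mean_step n ^^ k\<^sub>1) ((mean_step n ^^ m) (L1_dist_to_uniform n)) first_unit_vector"
    by (simp add: \<open>k = k\<^sub>1 + m\<close> funpow_add)
  also have "\<dots> \<le> (mean_step n ^^ k\<^sub>1)
      (\<lambda>v. (\<delta> + real n / \<delta> * exp (- real m / real n) * L) + 2 * L powr - \<alpha> * ?\<Psi> v) first_unit_vector"
    using assms L \<delta> by (intro funpow_mean_step_mono[OF closed_under_averaging_nonneg_vectors]
        funpow_mean_step_L1_dist_le) (auto simp: first_unit_vector_prob_vector)
  also have "\<dots> = (\<delta> + real n / \<delta> * exp (- real m / real n) * L)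
      + 2 * L powr - \<alpha> * (mean_step n ^^ k\<^sub>1) ?\<Psi> first_unit_vector"
    by (rule funpow_mean_step_affine[OF \<open>n \<ge> 2\<close>])
  also have "\<dots> \<le> (\<delta> + exp 1 * real n powr (- \<epsilon> / 2))
      + 2 * L powr - \<alpha> * ((exp 1 + 4 / c) * real n powr - \<alpha>)"
    using mid \<Psi> by (intro add_mono mult_left_mono) auto
  also have "2 * L powr - \<alpha> * ((exp 1 + 4 / c) * real n powr - \<alpha>) =
      2 * (exp 1 + 4 / c) * (real n powr ((\<epsilon> - 1) * - \<alpha>) * real n powr - \<alpha>)"
    by (simp add: L_def powr_powr)
  also have "real n powr ((\<epsilon> - 1) * - \<alpha>) * real n powr - \<alpha> = real n powr (- \<alpha> * \<epsilon>)"
    unfolding powr_add[symmetric] by (simp add: algebra_simps)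
  finally show ?thesis
    by (simp add: k_def l_def c_def \<delta>_def distrib_right)
qed

theorem theorem1p1:
  fixes M :: "nat \<Rightarrow> 'a measure"
    and IJ :: "nat \<Rightarrow> nat \<Rightarrow> 'a \<Rightarrow> nat \<times> nat"
    and x :: "nat \<Rightarrow> nat \<Rightarrow> 'a \<Rightarrow> nat \<Rightarrow> real"
  assumes chain: "\<And>n. n \<ge> 2 \<Longrightarrow>
    repeated_averaging_chain (M n) n first_unit_vector (IJ n) (x n)"
  shows "(\<forall>\<theta>::real. 0 \<le> \<theta> \<and> \<theta> < 1 / (2 * ln 2) \<longrightarrow>
      tendsto_in_probability M
        (\<lambda>n \<omega>. L1_dist_to_uniform n (x n (nat \<lfloor>\<theta> * real n * ln (real n)\<rfloor>) \<omega>)) 2) \<and>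
    (\<forall>\<theta>::real. \<theta> > 1 / (2 * ln 2) \<longrightarrow>
      tendsto_in_probability M
        (\<lambda>n \<omega>. L1_dist_to_uniform n (x n (nat \<lfloor>\<theta> * real n * ln (real n)\<rfloor>) \<omega>)) 0)"
proof (intro conjI allI impI)
  fix \<theta> :: real
  assume \<theta>: "0 \<le> \<theta> \<and> \<theta> < 1 / (2 * ln 2)"
  then obtain \<alpha> where \<alpha>: "0 < \<alpha>" "\<alpha> < 1" "2 * \<theta> * (2 powr \<alpha> - 1) < \<alpha>"
    using ex_exponent_lower by blast
  show "tendsto_in_probability M
      (\<lambda>n \<omega>. L1_dist_to_uniform n (x n (nat \<lfloor>\<theta> * real n * ln (real n)\<rfloor>) \<omega>)) 2"
  proof (rule tendsto_in_probability_chainI[where IJ = IJ, OF chain])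
    show "(\<lambda>n. 2 * real n powr (2 * \<theta> * (2 powr \<alpha> - 1) - \<alpha>)) \<longlonglongrightarrow> 0"
      using \<alpha> by (intro tendsto_mult_right_zero tendsto_real_powr_neg) auto
  qed (use \<theta> \<alpha> mean_L1_dist_minus_2_le in auto)
next
  fix \<theta> :: real
  assume "\<theta> > 1 / (2 * ln 2)"
  \<comment> \<open>An intermediate value still above the threshold leaves a positive multiple of
    \<open>n * ln n\<close> steps for the flattening phase.\<close>
  then obtain \<theta>\<^sub>1 where \<theta>\<^sub>1: "1 / (2 * ln 2) < \<theta>\<^sub>1" "\<theta>\<^sub>1 < \<theta>"
    using dense by blast
  then obtain \<alpha> where \<alpha>: "0 < \<alpha>" "\<alpha> < 1" "\<alpha> < 2 * \<theta>\<^sub>1 * (1 - 2 powr - \<alpha>)"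
    using ex_exponent_upper by blast
  have "0 < 1 / (2 * ln (2::real))"
    by simp
  then have "0 \<le> \<theta>\<^sub>1"
    using \<theta>\<^sub>1 by linarith
  define \<epsilon> where "\<epsilon> = (\<theta> - \<theta>\<^sub>1) / 2"
  have "0 < \<epsilon>"
    using \<theta>\<^sub>1 by (simp add: \<epsilon>_def)
  show "tendsto_in_probability M
      (\<lambda>n \<omega>. L1_dist_to_uniform n (x n (nat \<lfloor>\<theta> * real n * ln (real n)\<rfloor>) \<omega>)) 0"
  proof (rule tendsto_in_probability_chainI[where IJ = IJ, OF chain])
    show "(\<lambda>n. (1 + exp 1) * real n powr (- \<epsilon> / 2)
        + 2 * (exp 1 + 4 / (1 - 2 powr - \<alpha>)) * real n powr (- \<alpha> * \<epsilon>)) \<longlonglongrightarrow> 0"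
      using \<alpha> \<open>0 < \<epsilon>\<close> by (intro tendsto_add_zero tendsto_mult_right_zero tendsto_real_powr_neg) auto
  next
    fix n :: nat
    assume "n \<ge> 2"
    have "\<bar>L1_dist_to_uniform n v - 0\<bar> = L1_dist_to_uniform n v" for v
      by (simp add: L1_dist_to_uniform_def sum_nonneg)
    then show "(mean_step n ^^ nat \<lfloor>\<theta> * real n * ln (real n)\<rfloor>)
        (\<lambda>v. \<bar>L1_dist_to_uniform n v - 0\<bar>) first_unit_vector
      \<le> (1 + exp 1) * real n powr (- \<epsilon> / 2)
        + 2 * (exp 1 + 4 / (1 - 2 powr - \<alpha>)) * real n powr (- \<alpha> * \<epsilon>)"
      using mean_L1_dist_le[OF \<open>n \<ge> 2\<close> \<open>0 \<le> \<theta>\<^sub>1\<close> \<theta>\<^sub>1(2) \<alpha>] by (simp add: \<epsilon>_def)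
  qed
qed

end
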